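(* Consider the fuzzy linear system $A\tilde{\mathbf z}=\tilde{\mathbf b}$ with $A\in\mathbb{R}^{m\times n}$ and let $SZ=B$ be the associated $2m\times 2n$ crisp system. Then $SZ=B$ is consistent if and only if, for some $\{1,2\}$-inverse $S^{\{1,2\}}$ of $S$, $$SS^{\{1,2\}}B=B,$$ and in this case the general solution is $$Z=S^{\{1,2\}}B+(I-S^{\{1,2\}}S)h,\qquad h\in\mathbb{R}^{2n}\text{ arbitrary}.$$ Moreover, if the components $(\underline z_i(\alpha),\overline z_i(\alpha))$, $1\le i\le n$, of the obtained solution vector are all fuzzy numbers, then the fuzzy linear system admits a strong fuzzy solution; otherwise it yields a weak fuzzy solution.
   Context: A fuzzy number in parametric form is a pair $(\underline a(\alpha),\overline a(\alpha))$, $0\le\alpha\le1$, with $\underline a$ bounded, left-continuous, non-decreasing, $\overline a$ bounded, left-continuous, non-increasing, and $\underline a(\alpha)\le\overline a(\alpha)$ for all $\alpha\in[0,1]$. A fuzzy vector is a vector of fuzzy numbers. A fuzzy linear system (FLS) is $A\tilde{\mathbf z}=\tilde{\mathbf b}$ with $A=(d_{ij})\in\mathbb{R}^{m\times n}$ a real matrix, $\tilde{\mathbf b}=(\tilde b_i)$, $\tilde b_i=(\underline b_i(\alpha),\overline b_i(\alpha))$, a given fuzzy vector, and $\tilde{\mathbf z}=(\tilde z_j)$ unknown. Associated crisp system $SZ=B$: $S=\begin{bmatrix} S_1 & S_2\\ S_2 & S_1\end{bmatrix}\in\mathbb{R}^{2m\times 2n}$, where $(S_1)_{ij}=d_{ij}$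 if $d_{ij}\ge0$ and $0$ otherwise, $(S_2)_{ij}=-d_{ij}$ if $d_{ij}<0$ and $0$ otherwise; $Z=(\underline z_1,\dots,\underline z_n,-\overline z_1,\dots,-\overline z_n)^T$, $B=(\underline b_1,\dots,\underline b_m,-\overline b_1,\dots,-\overline b_m)^T$. Equations involving $Z,B$ are understood for each $\alpha\in[0,1]$. A $\{1,2\}$-inverse of $S$ is a matrix $Y$ with $SYS=S$ and $YSY=Y$. Given a solution $Z$ of $SZ=B$ with components $(\underline z_i(\alpha),\overline z_i(\alpha))$, its fuzzy solution is $W=\{(\underline w_i(\alpha),\overline w_i(\alpha))\}_{i=1}^n$ with $\underline w_i(\alpha)=\min\{\underline z_i(\alpha),\overline z_i(\alpha),\underline z_i(1),\overline z_i(1)\}$ and $\overline w_i(\alpha)=\max\{\underline z_i(\alpha),\overline z_i(\alpha),\underline z_i(1),\overline z_i(1)\}$. If all $(\underline z_i(\alpha),\overline z_i(\alpha))$ are fuzzy numbers (so that $\underline w_i=\underline z_i$, $\overline w_i=\overline z_i$), $W$ is called a strong fuzzy solution; otherwise a weak fuzzy solution (a weak fuzzy solution need not be a fuzzy vector). *)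

theory Defs
  imports "HOL-Analysis.Analysis"
begin

text \<open>Parametric pairs are total functions on the reals; only their values on
  the interval \<open>{0..1}\<close> are meaningful. All conditions and equations below are restricted to it.\<close>

type_synonym param_pair = "(real \<Rightarrow> real) \<times> (real \<Rightarrow> real)"

text \<open>At 0 left-continuity is vacuous, the domain being \<open>{0..1}\<close>.\<close>

definition left_continuous01 :: "(real \<Rightarrow> real) \<Rightarrow> bool" where
  "left_continuous01 f \<longleftrightarrow> (\<forall>\<alpha>\<in>{0<..1}. continuous (at_left \<alpha>) f)"

definition fuzzy_number :: "param_pair \<Rightarrow> bool" where
  "fuzzy_number a \<longleftrightarrow>
     bounded (fst a ` {0..1}) \<and> left_continuous01 (fst a) \<and> mono_on {0..1} (fst a) \<and>
     bounded (snd a ` {0..1}) \<and> left_continuous01 (snd a) \<and> antimono_on {0..1} (snd a) \<and>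
     (\<forall>\<alpha>\<in>{0..1}. fst a \<alpha> \<le> snd a \<alpha>)"

definition fuzzy_vector :: "param_pair ^ 'n \<Rightarrow> bool" where
  "fuzzy_vector v \<longleftrightarrow> (\<forall>i. fuzzy_number (v $ i))"

text \<open>Multiplication by a negative scalar swaps the two branches of a fuzzy number.\<close>

definition fuzzy_scale :: "real \<Rightarrow> param_pair \<Rightarrow> param_pair" where
  "fuzzy_scale c a =
     (if c \<ge> 0 then (\<lambda>\<alpha>. c * fst a \<alpha>, \<lambda>\<alpha>. c * snd a \<alpha>)
      else (\<lambda>\<alpha>. c * snd a \<alpha>, \<lambda>\<alpha>. c * fst a \<alpha>))"

text \<open>The fuzzy vector \<open>w\<close> satisfies the fuzzy linear system with matrix \<open>A\<close> and
  right-hand side \<open>b\<close>; sums of fuzzy numbers are taken branchwise.\<close>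

definition fls_solution :: "real ^ 'n ^ 'm \<Rightarrow> param_pair ^ 'm \<Rightarrow> param_pair ^ 'n \<Rightarrow> bool" where
  "fls_solution A b w \<longleftrightarrow> fuzzy_vector w \<and>
     (\<forall>i. \<forall>\<alpha>\<in>{0..1}.
        (\<Sum>j\<in>UNIV. fst (fuzzy_scale (A $ i $ j) (w $ j)) \<alpha>) = fst (b $ i) \<alpha> \<and>
        (\<Sum>j\<in>UNIV. snd (fuzzy_scale (A $ i $ j) (w $ j)) \<alpha>) = snd (b $ i) \<alpha>)"

definition S1 :: "real ^ 'n ^ 'm \<Rightarrow> real ^ 'n ^ 'm" where
  "S1 A = (\<chi> i j. if A $ i $ j \<ge> 0 then A $ i $ j else 0)"

definition S2 :: "real ^ 'n ^ 'm \<Rightarrow> real ^ 'n ^ 'm" where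
  "S2 A = (\<chi> i j. if A $ i $ j < 0 then - (A $ i $ j) else 0)"

text \<open>The index type \<open>'n + 'n\<close> has \<open>2 * CARD('n)\<close> elements: \<open>Inl\<close> addresses the first
  block (lower branches), \<open>Inr\<close> the second one (negated upper branches).\<close>

definition crisp_matrix :: "real ^ 'n ^ 'm \<Rightarrow> real ^ ('n + 'n) ^ ('m + 'm)" where
  "crisp_matrix A = (\<chi> r c.
     case (r, c) of
       (Inl i, Inl j) \<Rightarrow> S1 A $ i $ j
     | (Inl i, Inr j) \<Rightarrow> S2 A $ i $ j
     | (Inr i, Inl j) \<Rightarrow> S2 A $ i $ j
     | (Inr i, Inr j) \<Rightarrow> S1 A $ i $ j)"

definition crisp_rhs :: "param_pair ^ 'm \<Rightarrow> real \<Rightarrow> real ^ ('m + 'm)" where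
  "crisp_rhs b \<alpha> = (\<chi> r. case r of Inl i \<Rightarrow> fst (b $ i) \<alpha> | Inr i \<Rightarrow> - snd (b $ i) \<alpha>)"

definition crisp_solution ::
    "real ^ 'n ^ 'm \<Rightarrow> param_pair ^ 'm \<Rightarrow> (real \<Rightarrow> real ^ ('n + 'n)) \<Rightarrow> bool" where
  "crisp_solution A b Z \<longleftrightarrow> (\<forall>\<alpha>\<in>{0..1}. crisp_matrix A *v Z \<alpha> = crisp_rhs b \<alpha>)"

definition crisp_consistent :: "real ^ 'n ^ 'm \<Rightarrow> param_pair ^ 'm \<Rightarrow> bool" where
  "crisp_consistent A b \<longleftrightarrow> (\<exists>Z. crisp_solution A b Z)"

definition is_12_inverse :: "real ^ 'p ^ 'q \<Rightarrow> real ^ 'q ^ 'p \<Rightarrow> bool" where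
  "is_12_inverse S Y \<longleftrightarrow> S ** Y ** S = S \<and> Y ** S ** Y = Y"

text \<open>The pairs \<open>(lower z, upper z)\<close> read off from \<open>Z\<close>, undoing the sign in the second block.\<close>

definition branch_pairs :: "(real \<Rightarrow> real ^ ('n + 'n)) \<Rightarrow> param_pair ^ 'n" where
  "branch_pairs Z = (\<chi> i. (\<lambda>\<alpha>. Z \<alpha> $ Inl i, \<lambda>\<alpha>. - (Z \<alpha> $ Inr i)))"

definition fuzzy_solution :: "(real \<Rightarrow> real ^ ('n + 'n)) \<Rightarrow> param_pair ^ 'n" where
  "fuzzy_solution Z = (\<chi> i.
     let l = fst (branch_pairs Z $ i); u = snd (branch_pairs Z $ i) in
       (\<lambda>\<alpha>. Min {l \<alpha>, u \<alpha>, l 1, u 1}, \<lambda>\<alpha>. Max {l \<alpha>, u \<alpha>, l 1, u 1}))"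

text \<open>Being strong or weak is a property of \<open>W\<close> relative to the crisp solution \<open>Z\<close> it is
  built from: different crisp solutions may lead to the same \<open>W\<close>.\<close>

definition strong_fuzzy_solution ::
    "real ^ 'n ^ 'm \<Rightarrow> param_pair ^ 'm \<Rightarrow> (real \<Rightarrow> real ^ ('n + 'n)) \<Rightarrow> param_pair ^ 'n \<Rightarrow> bool" where
  "strong_fuzzy_solution A b Z W \<longleftrightarrow>
     crisp_solution A b Z \<and> W = fuzzy_solution Z \<and> (\<forall>i. fuzzy_number (branch_pairs Z $ i))"

definition weak_fuzzy_solution ::
    "real ^ 'n ^ 'm \<Rightarrow> param_pair ^ 'm \<Rightarrow> (real \<Rightarrow> real ^ ('n + 'n)) \<Rightarrow> param_pair ^ 'n \<Rightarrow> bool" where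
  "weak_fuzzy_solution A b Z W \<longleftrightarrow>
     crisp_solution A b Z \<and> W = fuzzy_solution Z \<and> \<not> (\<forall>i. fuzzy_number (branch_pairs Z $ i))"

end

theory Submission
  imports Defs
begin

text \<open>
  The matrix half of the theorem is the standard theory of generalized inverses. Every real matrix
  \<open>S\<close> has a \<open>{1,2}\<close>-inverse: a linear right inverse \<open>G\<close> of \<open>S\<close> on its range satisfies \<open>SGS = S\<close>,
  and \<open>GSG\<close> then satisfies both equations (\<open>ex_12_inverse\<close>). If \<open>SYS = S\<close>, then \<open>SY\<close> fixes exactly
  the vectors in the range of \<open>S\<close>, and \<open>I - YS\<close> projects onto the kernel of \<open>S\<close>; the first fact is
  the consistency criterion and the second one gives the general solution
  (\<open>consistent_imp_fixed\<close>, \<open>general_solution_iff\<close>). Both are applied separately at each \<open>\<alpha>\<close>.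

  The fuzzy half rests on two observations. If \<open>(l, u)\<close> is a fuzzy number, monotonicity gives
  \<open>l \<alpha> \<le> l 1 \<le> u 1 \<le> u \<alpha>\<close>, so the minimum and maximum in the fuzzy solution \<open>W\<close> merely
  return \<open>l\<close> and \<open>u\<close> (\<open>Min_Max_fuzzy_number\<close>). And splitting \<open>A\<close> by the signs of its entries
  mirrors the rule that a negative scalar swaps the branches, so a row of the crisp system says
  the same as one branch of an equation of the fuzzy system (\<open>crisp_row_Inl\<close>, \<open>crisp_row_Inr\<close>).
  Thus a crisp solution whose branch pairs are fuzzy numbers solves the fuzzy system.
\<close>

section \<open>Generalized inverses and linear systems\<close>

lemma ex_12_inverse:
  fixes S :: "real ^ 'p ^ 'q"
  shows "\<exists>Y. is_12_inverse S Y"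
proof -
  obtain g where "linear g" and g: "\<And>v. v \<in> range ((*v) S) \<Longrightarrow> S *v g v = v"
    using linear_exists_right_inverse_on[OF matrix_vector_mul_linear subspace_UNIV, of S] by blast
  define G where "G = matrix g"
  have G_v: "G *v v = g v" for v
    using \<open>linear g\<close> by (simp add: G_def matrix_works)
  have SGS: "S ** G ** S = S"
    unfolding matrix_eq by (simp add: matrix_vector_mul_assoc[symmetric] G_v g)
  \<comment> \<open>\<open>G\<close> need not satisfy the second equation; sandwiching \<open>S\<close> between two copies of it repairs this.\<close>
  have "S ** (G ** S ** G) ** S = S" "(G ** S ** G) ** S ** (G ** S ** G) = G ** S ** G"
    using SGS by (metis matrix_mul_assoc)+
  then show ?thesis
    unfolding is_12_inverse_def by blast
qed

lemma consistent_imp_fixed: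
  fixes S :: "real ^ 'p ^ 'q"
  assumes "S ** Y ** S = S" and "S *v z = c"
  shows "(S ** Y) *v c = c"
  using assms by (metis matrix_vector_mul_assoc)

text \<open>The vector \<open>Yc\<close> is a particular solution and every \<open>(I - YS)h\<close> lies in the kernel of \<open>S\<close>.
  Conversely a solution \<open>z\<close> equals \<open>YSz + (I - YS)z\<close>, so it serves as its own parameter \<open>h\<close>.\<close>

lemma general_solution_iff:
  fixes S :: "real ^ 'p ^ 'q"
  assumes SYS: "S ** Y ** S = S" and fixed: "(S ** Y) *v c = c"
  shows "S *v z = c \<longleftrightarrow> (\<exists>h. z = Y *v c + (mat 1 - Y ** S) *v h)"
proof
  assume "S *v z = c"
  then have "z = Y *v c + (mat 1 - Y ** S) *v z"
    by (simp add: matrix_vector_mult_diff_rdistrib matrix_vector_mul_assoc[symmetric])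
  then show "\<exists>h. z = Y *v c + (mat 1 - Y ** S) *v h" ..
next
  assume "\<exists>h. z = Y *v c + (mat 1 - Y ** S) *v h"
  then obtain h where z: "z = Y *v c + (mat 1 - Y ** S) *v h" ..
  have "S *v (Y *v (S *v h)) = S *v h"
    using SYS by (metis matrix_vector_mul_assoc)
  then show "S *v z = c"
    using fixed
    by (simp add: z matrix_vector_mult_diff_rdistrib matrix_vector_right_distrib
        matrix_vector_mult_diff_distrib matrix_vector_mul_assoc[symmetric])
qed

lemma crisp_consistent_iff:
  fixes A :: "real ^ 'n ^ 'm" and b :: "param_pair ^ 'm"
  shows "crisp_consistent A b \<longleftrightarrow>
    (\<exists>Y. is_12_inverse (crisp_matrix A) Y \<and>
       (\<forall>\<alpha>\<in>{0..1}. (crisp_matrix A ** Y) *v crisp_rhs b \<alpha> = crisp_rhs b \<alpha>))"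
proof
  assume "crisp_consistent A b"
  then obtain Z where Z: "\<forall>\<alpha>\<in>{0..1}. crisp_matrix A *v Z \<alpha> = crisp_rhs b \<alpha>"
    unfolding crisp_consistent_def crisp_solution_def by blast
  obtain Y where Y: "is_12_inverse (crisp_matrix A) Y"
    using ex_12_inverse by blast
  then have "\<forall>\<alpha>\<in>{0..1}. (crisp_matrix A ** Y) *v crisp_rhs b \<alpha> = crisp_rhs b \<alpha>"
    using Z consistent_imp_fixed unfolding is_12_inverse_def by blast
  with Y show "\<exists>Y. is_12_inverse (crisp_matrix A) Y \<and>
      (\<forall>\<alpha>\<in>{0..1}. (crisp_matrix A ** Y) *v crisp_rhs b \<alpha> = crisp_rhs b \<alpha>)"
    by blast
next
  assume "\<exists>Y. is_12_inverse (crisp_matrix A) Y \<and>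
      (\<forall>\<alpha>\<in>{0..1}. (crisp_matrix A ** Y) *v crisp_rhs b \<alpha> = crisp_rhs b \<alpha>)"
  then obtain Y where "\<forall>\<alpha>\<in>{0..1}. (crisp_matrix A ** Y) *v crisp_rhs b \<alpha> = crisp_rhs b \<alpha>"
    by blast
  then have "crisp_solution A b (\<lambda>\<alpha>. Y *v crisp_rhs b \<alpha>)"
    by (simp add: crisp_solution_def matrix_vector_mul_assoc)
  then show "crisp_consistent A b"
    unfolding crisp_consistent_def by blast
qed

lemma crisp_solution_iff:
  fixes A :: "real ^ 'n ^ 'm"
  assumes "is_12_inverse (crisp_matrix A) Y"
    and "\<forall>\<alpha>\<in>{0..1}. (crisp_matrix A ** Y) *v crisp_rhs b \<alpha> = crisp_rhs b \<alpha>"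
  shows "crisp_solution A b Z \<longleftrightarrow>
    (\<forall>\<alpha>\<in>{0..1}. \<exists>h. Z \<alpha> = Y *v crisp_rhs b \<alpha> + (mat 1 - Y ** crisp_matrix A) *v h)"
  unfolding crisp_solution_def
  using assms general_solution_iff[of "crisp_matrix A" Y] by (simp add: is_12_inverse_def)

section \<open>Fuzzy numbers\<close>

text \<open>Left limits at a point of \<open>(0, 1]\<close> only see values inside the unit interval, so being a fuzzy
  number does not depend on the junk values of the two branches outside it.\<close>

lemma left_continuous01_cong:
  assumes "\<And>\<alpha>. \<alpha> \<in> {0..1} \<Longrightarrow> f \<alpha> = g \<alpha>"
  shows "left_continuous01 f \<longleftrightarrow> left_continuous01 g"
  unfolding left_continuous01_def
proof (rule ball_cong[OF refl])
  fix \<alpha> :: real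
  assume \<alpha>: "\<alpha> \<in> {0<..1}"
  have "eventually (\<lambda>x. x \<in> {0<..<\<alpha>}) (at_left \<alpha>)"
    using \<alpha> by (intro eventually_at_left_real) auto
  then have "eventually (\<lambda>x. f x = g x) (at_left \<alpha>)"
    by eventually_elim (use \<alpha> assms in auto)
  moreover have "f \<alpha> = g \<alpha>"
    using \<alpha> assms by auto
  ultimately show "continuous (at_left \<alpha>) f \<longleftrightarrow> continuous (at_left \<alpha>) g"
    unfolding continuous_within by (simp add: tendsto_cong[of f g])
qed

lemma fuzzy_number_cong:
  assumes "\<And>\<alpha>. \<alpha> \<in> {0..1} \<Longrightarrow> fst a \<alpha> = fst c \<alpha>"
    and "\<And>\<alpha>. \<alpha> \<in> {0..1} \<Longrightarrow> snd a \<alpha> = snd c \<alpha>"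
  shows "fuzzy_number a \<longleftrightarrow> fuzzy_number c"
proof -
  have "fst a ` {0..1} = fst c ` {0..1}" "snd a ` {0..1} = snd c ` {0..1}"
    using assms by (auto intro!: image_cong)
  moreover have "mono_on {0..1} (fst a) \<longleftrightarrow> mono_on {0..1} (fst c)"
    "antimono_on {0..1} (snd a) \<longleftrightarrow> antimono_on {0..1} (snd c)"
    using assms by (simp_all add: monotone_on_def)
  moreover have "left_continuous01 (fst a) \<longleftrightarrow> left_continuous01 (fst c)"
    "left_continuous01 (snd a) \<longleftrightarrow> left_continuous01 (snd c)"
    using assms by (auto intro!: left_continuous01_cong)
  ultimately show ?thesis
    using assms by (simp add: fuzzy_number_def)
qed

lemma Min_Max_fuzzy_number:
  assumes "fuzzy_number (l, u)" and \<alpha>: "\<alpha> \<in> {0..1}"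
  shows "Min {l \<alpha>, u \<alpha>, l 1, u 1} = l \<alpha>" and "Max {l \<alpha>, u \<alpha>, l 1, u 1} = u \<alpha>"
proof -
  have "mono_on {0..1} l" "antimono_on {0..1} u" "l 1 \<le> u 1"
    using assms(1) by (auto simp: fuzzy_number_def)
  then have "l \<alpha> \<le> l 1" "l 1 \<le> u 1" "u 1 \<le> u \<alpha>"
    using \<alpha> by (auto simp: monotone_on_def)
  then show "Min {l \<alpha>, u \<alpha>, l 1, u 1} = l \<alpha>" "Max {l \<alpha>, u \<alpha>, l 1, u 1} = u \<alpha>"
    by auto
qed

lemma fuzzy_solution_eq_branches:
  assumes "fuzzy_number (branch_pairs Z $ j)" and "\<alpha> \<in> {0..1}"
  shows "fst (fuzzy_solution Z $ j) \<alpha> = Z \<alpha> $ Inl j"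
    and "snd (fuzzy_solution Z $ j) \<alpha> = - (Z \<alpha> $ Inr j)"
  using Min_Max_fuzzy_number[of "\<lambda>\<alpha>. Z \<alpha> $ Inl j" "\<lambda>\<alpha>. - (Z \<alpha> $ Inr j)" \<alpha>] assms
  by (simp_all add: fuzzy_solution_def branch_pairs_def Let_def)

section \<open>The crisp system and the fuzzy system\<close>

lemma sum_UNIV_Plus:
  fixes f :: "'a::finite + 'b::finite \<Rightarrow> 'c::comm_monoid_add"
  shows "sum f UNIV = (\<Sum>i\<in>UNIV. f (Inl i)) + (\<Sum>j\<in>UNIV. f (Inr j))"
  by (subst UNIV_Plus_UNIV[symmetric], subst sum.Plus) simp_all

text \<open>A negative entry \<open>d\<close> of \<open>A\<close> contributes \<open>d * upper\<close> to the lower branch; the crisp matrix writes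
  this as \<open>(-d) * (-upper)\<close>, which is why the second block of unknowns carries a sign.\<close>

lemma crisp_row_Inl:
  fixes A :: "real ^ 'n ^ 'm"
  assumes "\<And>j. fst (w $ j) \<alpha> = z $ Inl j" and "\<And>j. snd (w $ j) \<alpha> = - (z $ Inr j)"
  shows "(\<Sum>j\<in>UNIV. fst (fuzzy_scale (A $ i $ j) (w $ j)) \<alpha>) = (crisp_matrix A *v z) $ Inl i"
  by (auto simp: matrix_vector_mult_def crisp_matrix_def sum_UNIV_Plus S1_def S2_def
      fuzzy_scale_def assms sum.distrib[symmetric] intro!: sum.cong)

lemma crisp_row_Inr:
  fixes A :: "real ^ 'n ^ 'm"
  assumes "\<And>j. fst (w $ j) \<alpha> = z $ Inl j" and "\<And>j. snd (w $ j) \<alpha> = - (z $ Inr j)"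
  shows "(\<Sum>j\<in>UNIV. snd (fuzzy_scale (A $ i $ j) (w $ j)) \<alpha>) = - ((crisp_matrix A *v z) $ Inr i)"
  by (auto simp: matrix_vector_mult_def crisp_matrix_def sum_UNIV_Plus S1_def S2_def
      fuzzy_scale_def assms sum.distrib[symmetric] sum_negf[symmetric] simp del: sum_negf
      intro!: sum.cong)

lemma fls_solution_fuzzy_solution:
  fixes A :: "real ^ 'n ^ 'm"
  assumes Z: "crisp_solution A b Z" and fuzzy: "\<forall>i. fuzzy_number (branch_pairs Z $ i)"
  shows "fls_solution A b (fuzzy_solution Z)"
proof -
  have W: "fst (fuzzy_solution Z $ j) \<alpha> = Z \<alpha> $ Inl j"
    "snd (fuzzy_solution Z $ j) \<alpha> = - (Z \<alpha> $ Inr j)" if "\<alpha> \<in> {0..1}" for j \<alpha>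
    using fuzzy_solution_eq_branches fuzzy that by blast+
  have "fuzzy_number (fuzzy_solution Z $ j)" for j
    using fuzzy_number_cong[of "fuzzy_solution Z $ j" "branch_pairs Z $ j"] W fuzzy
    by (simp add: branch_pairs_def)
  moreover have "(\<Sum>j\<in>UNIV. fst (fuzzy_scale (A $ i $ j) (fuzzy_solution Z $ j)) \<alpha>) = fst (b $ i) \<alpha> \<and>
      (\<Sum>j\<in>UNIV. snd (fuzzy_scale (A $ i $ j) (fuzzy_solution Z $ j)) \<alpha>) = snd (b $ i) \<alpha>"
    if "\<alpha> \<in> {0..1}" for i \<alpha>
  proof -
    have "crisp_matrix A *v Z \<alpha> = crisp_rhs b \<alpha>"
      using Z that by (simp add: crisp_solution_def)
    then show ?thesis
      using crisp_row_Inl[OF W[OF that], of A i] crisp_row_Inr[OF W[OF that], of A i]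
      by (simp add: crisp_rhs_def)
  qed
  ultimately show ?thesis
    by (simp add: fls_solution_def fuzzy_vector_def)
qed

section \<open>Consistency, general solution and fuzzy solutions\<close>

theorem theorem3p7:
  fixes A :: "real ^ 'n ^ 'm" and b :: "param_pair ^ 'm"
  assumes "fuzzy_vector b"
  shows
    "(crisp_consistent A b \<longleftrightarrow>
       (\<exists>Y. is_12_inverse (crisp_matrix A) Y \<and>
          (\<forall>\<alpha>\<in>{0..1}. (crisp_matrix A ** Y) *v crisp_rhs b \<alpha> = crisp_rhs b \<alpha>)))
     \<and>
     (\<forall>Y. is_12_inverse (crisp_matrix A) Y \<and>
          (\<forall>\<alpha>\<in>{0..1}. (crisp_matrix A ** Y) *v crisp_rhs b \<alpha> = crisp_rhs b \<alpha>) \<longrightarrow>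
        (\<forall>Z. crisp_solution A b Z \<longleftrightarrow>
           (\<forall>\<alpha>\<in>{0..1}. \<exists>h :: real ^ ('n + 'n).
              Z \<alpha> = Y *v crisp_rhs b \<alpha> + (mat 1 - Y ** crisp_matrix A) *v h)) \<and>
        (\<forall>Z. (\<forall>\<alpha>\<in>{0..1}. \<exists>h :: real ^ ('n + 'n).
              Z \<alpha> = Y *v crisp_rhs b \<alpha> + (mat 1 - Y ** crisp_matrix A) *v h) \<longrightarrow>
           ((\<forall>i. fuzzy_number (branch_pairs Z $ i)) \<longrightarrow>
              (\<exists>W. strong_fuzzy_solution A b Z W \<and> fls_solution A b W)) \<and>
           (\<not> (\<forall>i. fuzzy_number (branch_pairs Z $ i)) \<longrightarrow>
              (\<exists>W. weak_fuzzy_solution A b Z W))))"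
  using crisp_consistent_iff[of A b]
    crisp_solution_iff[of A _ b] fls_solution_fuzzy_solution[of A b]
  unfolding strong_fuzzy_solution_def weak_fuzzy_solution_def by blast

end
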